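(* Let $G$ be a finite group. If $N$ is a normal subgroup of $G$, then $\mu(N)\le\mu(G)$. Hence $\mathbf{cx}(N)\le\mathbf{cx}(G)$.
   Context: All groups are finite. Functions $\mathbf{c}$ go from the class of finite groups to $\mathbb{N}=\{0,1,2,\dots\}$. The complexity axioms for $\mathbf{c}$ are the following five. (Extension) If $N\lhd G$, then $\mathbf{c}(G)\le \mathbf{c}(N)+\mathbf{c}(G/N)$. (Quotient) If there is a surjective homomorphism $G\to H$, then $\mathbf{c}(G)\ge \mathbf{c}(H)$. (Constructability) Every group $G$ has a subnormal series $\mathbf{1}=G_n\lhd G_{n-1}\lhd\cdots\lhd G_0=G$ (some $n\ge 0$) with $\mathbf{c}(G_i/G_{i+1})\le 1$ for all $0\le i<n$. (Product) If $G=H\times K$, then $\mathbf{c}(G)=\max(\mathbf{c}(H),\mathbf{c}(K))$. (Initial condition) $\mathbf{c}(\mathbf{1})=0$ for the trivial group $\mathbf{1}$. A complexity function is a function satisfying these five axioms. $\mathbf{cx}$ denotes the unique maximal (pointwise largest) complexity function on finite groups, $\mathbf{cx}(G)=\sup\{\mathbf{c}(G):\mathbf{c}\text{ a complexity function}\}$. For a finite group $G$, $\mu(G)$ is the shortest length $\ell$ of a subnormal series $\mathbf{1}=V_0\lhd V_1\lhd\cdots\lhd V_\ell=G$ such that each $V_{i+1}/V_i$ ($0\le i<\ell$) is isomorphic to a direct product of finitely many simple groups. *)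

theory Defs
  imports "HOL-Algebra.Algebra"
begin

text \<open>
  A function on the class of all finite groups is rendered as a function on groups whose elements
  are natural numbers; every finite group, of whatever type, is isomorphic to such a group.  A
  function \<open>c\<close> of this kind is evaluated on a group over another type (a quotient, whose elements
  are cosets, or a direct product) through \<open>nat_copy\<close>.  The choice of the copy is immaterial for
  complexity functions: the quotient axiom, applied to an isomorphism and its inverse, makes them
  isomorphism invariant.
\<close>

definition nat_copy :: "('a, 'b) monoid_scheme \<Rightarrow> nat monoid" where
  "nat_copy G = (SOME H. group H \<and> G \<cong> H)"

lemma nat_copy:
  fixes G (structure)
  assumes "group G" "finite (carrier G)"
  shows "group (nat_copy G)" "G \<cong> nat_copy G"
proof -
  interpret group G by fact
  obtain f :: "_ \<Rightarrow> nat" where f: "inj_on f (carrier G)"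
    using assms(2) by (metis finite_imp_inj_to_nat_seg)
  let ?g = "the_inv_into (carrier G) f"
  define H :: "nat monoid" where
    "H = \<lparr>carrier = f ` carrier G, monoid.mult = (\<lambda>x y. f (?g x \<otimes> ?g y)), one = f \<one>\<rparr>"
  have iso: "f \<in> iso G H"
    using f by (auto simp: iso_def hom_def bij_betw_def H_def the_inv_into_f_f)
  have "group (H\<lparr>one := f \<one>\<rparr>)"
    by (rule iso_imp_img_group[OF iso])
  moreover have "H\<lparr>one := f \<one>\<rparr> = H"
    by (simp add: H_def)
  ultimately have "group H \<and> G \<cong> H"
    using iso by (auto simp: is_iso_def)
  hence "group (nat_copy G) \<and> G \<cong> nat_copy G"
    unfolding nat_copy_def by (rule someI)
  thus "group (nat_copy G)" "G \<cong> nat_copy G" by auto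
qed

definition eval_group :: "(nat monoid \<Rightarrow> nat) \<Rightarrow> ('a, 'b) monoid_scheme \<Rightarrow> nat" where
  "eval_group c G = c (nat_copy G)"

definition subgrp :: "('a, 'b) monoid_scheme \<Rightarrow> 'a set \<Rightarrow> ('a, 'b) monoid_scheme" where
  "subgrp G H = G\<lparr>carrier := H\<rparr>"

text \<open>
  Only \<open>V 0, \<dots>, V n\<close> matter.  The series is indexed upwards from the trivial subgroup.  That
  each \<open>V i\<close> is a subgroup is part of the normality condition.
\<close>

definition subnormal_series :: "('a, 'b) monoid_scheme \<Rightarrow> nat \<Rightarrow> (nat \<Rightarrow> 'a set) \<Rightarrow> bool" where
  "subnormal_series G n V \<longleftrightarrow>
     V 0 = {\<one>\<^bsub>G\<^esub>} \<and> V n = carrier G \<and> (\<forall>i<n. V i \<lhd> subgrp G (V (Suc i)))"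

definition complexity_function :: "(nat monoid \<Rightarrow> nat) \<Rightarrow> bool" where
  "complexity_function c \<longleftrightarrow>
     \<comment> \<open>Extension\<close>
     (\<forall>(G :: nat monoid) N. group G \<longrightarrow> finite (carrier G) \<longrightarrow> N \<lhd> G \<longrightarrow>
        eval_group c G \<le> eval_group c (subgrp G N) + eval_group c (G Mod N)) \<and>
     \<comment> \<open>Quotient\<close>
     (\<forall>(G :: nat monoid) (H :: nat monoid). group G \<longrightarrow> finite (carrier G) \<longrightarrow> group H \<longrightarrow> epi G H \<noteq> {} \<longrightarrow> c H \<le> c G) \<and>
     \<comment> \<open>Constructability\<close>
     (\<forall>G :: nat monoid. group G \<longrightarrow> finite (carrier G) \<longrightarrow>
        (\<exists>n V. subnormal_series G n V \<and>
           (\<forall>i<n. eval_group c (subgrp G (V (Suc i)) Mod V i) \<le> 1))) \<and>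
     \<comment> \<open>Product\<close>
     (\<forall>(H :: nat monoid) (K :: nat monoid). group H \<longrightarrow> finite (carrier H) \<longrightarrow> group K \<longrightarrow> finite (carrier K) \<longrightarrow>
        eval_group c (H \<times>\<times> K) = max (c H) (c K)) \<and>
     \<comment> \<open>Initial condition\<close>
     (\<forall>G :: nat monoid. group G \<longrightarrow> carrier G = {\<one>\<^bsub>G\<^esub>} \<longrightarrow> c G = 0)"

text \<open>
  The supremum is taken in \<open>nat\<close>, where it is meaningful only for bounded sets.  The set is bounded:
  a complexity function is at most 1 on simple groups by constructability, hence at most the
  length of a composition series of \<open>G\<close> by the extension axiom.  It is nonempty, since the constant
  0 is a complexity function.
\<close>

definition cx :: "('a, 'b) monoid_scheme \<Rightarrow> nat" where
  "cx G = Sup {eval_group c G | c. complexity_function c}"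

definition product_of_simple_groups :: "('a, 'b) monoid_scheme \<Rightarrow> bool" where
  "product_of_simple_groups G \<longleftrightarrow>
     (\<exists>(k::nat) (S :: nat \<Rightarrow> nat monoid).
        (\<forall>j<k. simple_group (S j) \<and> finite (carrier (S j))) \<and> G \<cong> product_group {..<k} S)"

definition mu :: "('a, 'b) monoid_scheme \<Rightarrow> nat" where
  "mu G = (LEAST l. \<exists>V. subnormal_series G l V \<and>
     (\<forall>i<l. product_of_simple_groups (subgrp G (V (Suc i)) Mod V i)))"

end

theory Submission
  imports Defs
begin

text \<open>
  The inequality for \<open>cx\<close> reduces to the one for \<open>mu\<close> because \<open>cx = mu\<close> on finite groups: \<open>mu\<close>
  itself satisfies the complexity axioms, and every complexity function is at most 1 on simple
  groups by constructability, hence on products of simple groups by the product axiom, so the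
  extension axiom bounds it by the length of any series with such factors.

  All closure properties of \<open>mu\<close> come from those of finite products of simple groups, applied to
  the factors of a series that is intersected with a normal subgroup, mapped forwards or pulled
  back.  These products behave like semisimple modules: a finite group is such a product iff no
  proper normal subgroup contains all its simple normal subgroups.  This criterion passes to
  quotients and products, and it gives every normal subgroup a normal complement, so that normal
  subgroups are quotients as well.
\<close>

section \<open>Subgroups, quotients and isomorphisms\<close>

text \<open>Replaces the operations of the subgroup \<open>B\<close> by those of \<open>G\<close>,
  so that normality inside varying subgroups can be checked in one ambient group.\<close>

lemma normal_subgrp_iff:
  fixes G (structure)
  assumes "group G" "subgroup B G"
  shows "A \<lhd> subgrp G B \<longleftrightarrow>
    subgroup A G \<and> A \<subseteq> B \<and> (\<forall>x\<in>B. \<forall>h\<in>A. x \<otimes> h \<otimes> inv x \<in> A)"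
proof -
  interpret group G by fact
  interpret B: group "subgrp G B"
    using assms by (simp add: subgrp_def subgroup_imp_group)
  have "subgroup A (subgrp G B) \<longleftrightarrow> subgroup A G \<and> A \<subseteq> B"
    using assms incl_subgroup[of B A] subgroup_incl[of A B] subgroup.subset[of A "subgrp G B"]
    by (auto simp: subgrp_def)
  moreover have "inv\<^bsub>subgrp G B\<^esub> x = inv x" if "x \<in> B" for x
    using that assms m_inv_consistent[of B x] by (simp add: subgrp_def)
  ultimately show ?thesis
    by (auto simp: B.normal_inv_iff) (auto simp: subgrp_def)
qed

lemma carrier_subgrp [simp]: "carrier (subgrp G H) = H"
  and mult_subgrp [simp]: "x \<otimes>\<^bsub>subgrp G H\<^esub> y = x \<otimes>\<^bsub>G\<^esub> y"
  and one_subgrp [simp]: "\<one>\<^bsub>subgrp G H\<^esub> = \<one>\<^bsub>G\<^esub>"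
  and subgrp_subgrp [simp]: "subgrp (subgrp G A) B = subgrp G B"
  and subgrp_carrier [simp]: "subgrp G (carrier G) = G"
  by (auto simp: subgrp_def)

lemma group_subgrp: "group G \<Longrightarrow> subgroup H G \<Longrightarrow> group (subgrp G H)"
  by (simp add: subgrp_def group.subgroup_imp_group)

lemma group_Mod: "N \<lhd> G \<Longrightarrow> group (G Mod N)"
  by (rule normal.factorgroup_is_group)

lemma finite_Mod: "finite (carrier G) \<Longrightarrow> finite (carrier (G Mod N))"
  by (simp add: carrier_FactGroup)

lemma epi_Mod: "N \<lhd> G \<Longrightarrow> (\<lambda>x. N #>\<^bsub>G\<^esub> x) \<in> epi G (G Mod N)"
  by (auto simp: epi_def carrier_FactGroup normal.r_coset_hom_Mod)

lemma finite_iso: "G \<cong> H \<Longrightarrow> finite (carrier G) \<Longrightarrow> finite (carrier H)"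
  by (auto simp: is_iso_def iso_def bij_betw_finite)

lemma epi_group_hom: "group G \<Longrightarrow> group H \<Longrightarrow> f \<in> epi G H \<Longrightarrow> group_hom G H f"
  by (auto simp: epi_def group_hom_def group_hom_axioms_def)

lemma iso_imp_epi: "f \<in> iso G H \<Longrightarrow> f \<in> epi G H"
  by (auto simp: iso_def epi_def bij_betw_def)

lemma Mod_kernel_iso:
  assumes "group G" "group H" "f \<in> epi G H"
  shows "G Mod kernel G H f \<cong> H"
  using group_hom.FactGroup_iso[OF epi_group_hom[OF assms]] assms(3) by (simp add: epi_def)

lemma Mod_one_iso:
  assumes "group G"
  shows "G Mod {\<one>\<^bsub>G\<^esub>} \<cong> G"
proof -
  have "id \<in> epi G G" "kernel G G id = {\<one>\<^bsub>G\<^esub>}"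
    using assms by (auto simp: epi_def hom_def kernel_def group.is_monoid)
  thus ?thesis using Mod_kernel_iso[of G G id] assms by simp
qed

lemma normal_vimage:
  assumes "group_hom G H f" "M \<lhd> H"
  shows "{x \<in> carrier G. f x \<in> M} \<lhd> G"
proof -
  interpret f: group_hom G H f by fact
  interpret M: normal M H by fact
  show ?thesis
    by (rule f.G.normal_invI) (auto intro!: subgroup.intro M.inv_op_closed2)
qed

lemma normal_restrict:
  assumes "group G" "N \<lhd> G" "subgroup H G"
  shows "N \<inter> H \<lhd> subgrp G H"
proof -
  interpret H: subgroup H G by fact
  show ?thesis
    using assms group.normal_invE[OF assms(1,2)]
    by (auto simp: normal_subgrp_iff subgroup_Int)
qed

section \<open>Groups generated by their simple normal subgroups\<close>

text \<open>Equivalent to: the simple normal subgroups together generate \<open>G\<close>.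
  Quantifying over the normal subgroups that contain them avoids constructing the generated subgroup
  and lets proofs work with preimages of \<open>M\<close>.\<close>

definition socle_generated :: "('a, 'b) monoid_scheme \<Rightarrow> bool" where
  "socle_generated G \<longleftrightarrow> (\<forall>M. M \<lhd> G \<longrightarrow>
     (\<forall>S. S \<lhd> G \<longrightarrow> simple_group (subgrp G S) \<longrightarrow> S \<subseteq> M) \<longrightarrow> M = carrier G)"

lemma iso_subgrp_image:
  assumes "group_hom G H f" "subgroup S G" "inj_on f S"
  shows "f \<in> iso (subgrp G S) (subgrp H (f ` S))"
  using assms subgroup.subset[OF assms(2)]
  by (auto simp: iso_def hom_def bij_betw_def group_hom_def group_hom_axioms_def subset_iff)

text \<open>The kernel meets \<open>S\<close> in a normal subgroup of \<open>S\<close>. By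
  simplicity this is all of \<open>S\<close>, and the image is trivial, or it is trivial, and
  \<open>f\<close> embeds \<open>S\<close>.\<close>

lemma simple_normal_image:
  assumes "group G" "group H" "f \<in> epi G H" "S \<lhd> G" "simple_group (subgrp G S)"
  shows "f ` S = {\<one>\<^bsub>H\<^esub>} \<or> f ` S \<lhd> H \<and> simple_group (subgrp H (f ` S))"
proof -
  interpret f: group_hom G H f using assms(1-3) by (rule epi_group_hom)
  interpret S: normal S G by fact
  interpret S': simple_group "subgrp G S" by fact
  have fS: "f ` S \<lhd> H"
    using S.surj_hom_normal_subgroup[OF f.group_hom_axioms] assms(3) by (simp add: epi_def)
  have "kernel G H f \<inter> S \<lhd> subgrp G S"
    by (rule normal_restrict) (auto simp: f.normal_kernel S.subgroup_axioms assms)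
  from S'.no_real_normal_subgroup[OF this] show ?thesis
  proof
    assume "kernel G H f \<inter> S = carrier (subgrp G S)"
    hence "\<forall>x\<in>S. f x = \<one>\<^bsub>H\<^esub>" by (auto simp: kernel_def)
    moreover have "S \<noteq> {}" using S.one_closed by blast
    ultimately have "f ` S = {\<one>\<^bsub>H\<^esub>}" by (simp add: image_constant_conv cong: image_cong)
    thus ?thesis ..
  next
    assume *: "kernel G H f \<inter> S = {\<one>\<^bsub>subgrp G S\<^esub>}"
    have "f \<in> hom (subgrp G S) H"
      by (auto simp: hom_def)
    then interpret fS: group_hom "subgrp G S" H f
      by (simp add: group_hom_def group_hom_axioms_def S'.is_group f.H.is_group)
    have "inj_on f S"
      using * fS.inj_on_one_iff S.subset S.one_closed by (auto simp: kernel_def set_eq_iff)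
    hence "f \<in> iso (subgrp G S) (subgrp H (f ` S))"
      by (intro iso_subgrp_image S.subgroup_axioms f.group_hom_axioms)
    hence "simple_group (subgrp H (f ` S))"
      by (rule S'.iso_simple[rotated])
        (simp add: group_subgrp fS f.H.is_group normal_imp_subgroup)
    with fS show ?thesis by blast
  qed
qed

text \<open>The preimage of \<open>M\<close> is normal in \<open>G\<close> and contains every simple
  normal subgroup \<open>S\<close>, because the image of \<open>S\<close> is trivial or again simple
  and normal. Hence the preimage is all of \<open>G\<close>.\<close>

lemma socle_generated_epi:
  assumes "group G" "group H" "f \<in> epi G H" "socle_generated G"
  shows "socle_generated H"
  unfolding socle_generated_def
proof (intro allI impI)
  fix M assume M: "M \<lhd> H" and *: "\<forall>S. S \<lhd> H \<longrightarrow> simple_group (subgrp H S) \<longrightarrow> S \<subseteq> M"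
  interpret f: group_hom G H f using assms(1-3) by (rule epi_group_hom)
  interpret M: normal M H by fact
  let ?P = "{x \<in> carrier G. f x \<in> M}"
  have "S \<subseteq> ?P" if S: "S \<lhd> G" "simple_group (subgrp G S)" for S
  proof -
    have "f ` S \<subseteq> M"
      using simple_normal_image[OF assms(1-3) S] * M.one_closed by (metis empty_subsetI insert_subset)
    thus ?thesis using subgroup.subset[OF normal_imp_subgroup[OF S(1)]] by auto
  qed
  hence "?P = carrier G"
    using assms(4)[unfolded socle_generated_def, rule_format, OF normal_vimage[OF f.group_hom_axioms M]]
    by blast
  hence "f ` carrier G \<subseteq> M" by blast
  thus "M = carrier H"
    using assms(3) M.subset by (simp add: epi_def)
qed

lemma socle_generated_iso:
  assumes "group G" "group H" "G \<cong> H" "socle_generated G"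
  shows "socle_generated H"
  using assms socle_generated_epi[OF assms(1,2)] iso_imp_epi
  unfolding is_iso_def by blast

lemma subset_set_mult:
  fixes G (structure)
  assumes "group G" "subgroup A G" "subgroup B G"
  shows "A \<subseteq> A <#> B" "B \<subseteq> A <#> B"
proof -
  interpret group G by fact
  interpret A: subgroup A G by fact
  interpret B: subgroup B G by fact
  show "A \<subseteq> A <#> B"
  proof
    fix x assume "x \<in> A"
    moreover from this have "x = x \<otimes> \<one>" by simp
    ultimately show "x \<in> A <#> B" using B.one_closed unfolding set_mult_def by blast
  qed
  show "B \<subseteq> A <#> B"
  proof
    fix x assume "x \<in> B"
    moreover from this have "x = \<one> \<otimes> x" by simp
    ultimately show "x \<in> A <#> B" using A.one_closed unfolding set_mult_def by blast
  qed
qed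

text \<open>As for semisimple modules, \<open>M\<close> is chosen maximal among the normal subgroups
  meeting \<open>N\<close> trivially. A simple normal \<open>S\<close> outside
  \<open>N <#> M\<close> meets it trivially, and then \<open>M <#> S\<close> is a strictly larger
  candidate. So \<open>N <#> M\<close> contains every simple normal subgroup.\<close>

lemma socle_generated_complement:
  fixes G (structure)
  assumes "group G" "finite (carrier G)" "socle_generated G" "N \<lhd> G"
  obtains M where "M \<lhd> G" "N \<inter> M = {\<one>}" "N <#> M = carrier G"
proof -
  interpret group G by fact
  interpret N: normal N G by fact
  let ?C = "{M. M \<lhd> G \<and> N \<inter> M = {\<one>}}"
  have "?C \<subseteq> Pow (carrier G)"
    by (auto dest!: normal_imp_subgroup subgroup.subset)
  hence fin: "finite ?C" using assms(2) by (simp add: finite_subset)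
  have "{\<one>} \<in> ?C" using N.one_closed by (auto simp: one_is_normal)
  hence "?C \<noteq> {}" by blast
  from finite_has_maximal[OF fin this] obtain M where "M \<in> ?C"
    and max: "\<And>K. K \<in> ?C \<Longrightarrow> M \<subseteq> K \<Longrightarrow> M = K" by (metis (lifting))
  from \<open>M \<in> ?C\<close> have M: "M \<lhd> G" "N \<inter> M = {\<one>}" unfolding mem_Collect_eq by blast+
  interpret M: normal M G by fact
  have NM: "N <#> M \<lhd> G" using M assms(4) by (intro normal_subgroup_set_mult_closed)
  have sub: "N \<subseteq> N <#> M" "M \<subseteq> N <#> M"
    using subset_set_mult[OF is_group N.subgroup_axioms M.subgroup_axioms] .
  have "S \<subseteq> N <#> M" if S: "S \<lhd> G" "simple_group (subgrp G S)" for S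
  proof (rule ccontr)
    assume nS: "\<not> S \<subseteq> N <#> M"
    interpret S: normal S G by fact
    interpret NM: normal "N <#> M" G by fact
    have "(N <#> M) \<inter> S \<lhd> subgrp G S"
      using NM S.subgroup_axioms is_group by (intro normal_restrict)
    hence 1: "(N <#> M) \<inter> S = {\<one>}"
      using simple_group.no_real_normal_subgroup[OF S(2)] nS by fastforce
    have MS: "M <#> S \<lhd> G" using M S by (intro normal_subgroup_set_mult_closed)
    interpret MS: normal "M <#> S" G by fact
    have sub': "M \<subseteq> M <#> S" "S \<subseteq> M <#> S"
      using subset_set_mult[OF is_group M.subgroup_axioms S.subgroup_axioms] .
    \<comment> \<open>In \<open>n = m \<otimes> s\<close> the factor \<open>s\<close> equals
      \<open>inv m \<otimes> n\<close>, so it lies both in \<open>S\<close> and in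
      \<open>N <#> M\<close> and is trivial. Thus \<open>n\<close> lies in
      \<open>N \<inter> M\<close>.\<close>
    have "n = \<one>" if n: "n \<in> N" "n \<in> M <#> S" for n
    proof -
      obtain m s where ms: "m \<in> M" "s \<in> S" "n = m \<otimes> s" using n unfolding set_mult_def by auto
      hence "s = inv m \<otimes> n" by (simp add: inv_solve_left M.subset S.subset subsetD)
      moreover have "inv m \<in> N <#> M" "n \<in> N <#> M" using ms n sub by auto
      ultimately have "s \<in> N <#> M" by auto
      hence "s = \<one>" using 1 ms by auto
      hence "n \<in> M" using ms by simp
      thus ?thesis using M n by auto
    qed
    hence "N \<inter> (M <#> S) = {\<one>}" using N.one_closed MS.one_closed by auto
    hence "M <#> S = M" using max[of "M <#> S"] MS sub' by simp
    with nS sub sub' show False by blast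
  qed
  hence "N <#> M = carrier G"
    using assms(3) NM by (simp add: socle_generated_def)
  with M show ?thesis using that by blast
qed

text \<open>Normal subgroups with trivial intersection commute elementwise, so multiplication is a
  homomorphism on their direct product, and it is bijective by the two conditions on
  \<open>N\<close> and \<open>M\<close>. The second claim is the second isomorphism theorem.\<close>

lemma normal_complement_iso:
  fixes G (structure)
  assumes "group G" "N \<lhd> G" "M \<lhd> G" "N \<inter> M = {\<one>}" "N <#> M = carrier G"
  shows "subgrp G N \<times>\<times> subgrp G M \<cong> G" "G Mod N \<cong> subgrp G M"
proof -
  interpret group G by fact
  interpret N: normal N G by fact
  interpret M: normal M G by fact
  interpret gM: group "subgrp G M" using is_group M.subgroup_axioms by (rule group_subgrp)
  interpret gN: group "subgrp G N" using is_group N.subgroup_axioms by (rule group_subgrp)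
  have com: "x \<otimes> y = y \<otimes> x" if "x \<in> N" "y \<in> M" for x y
    using normal_imp_commuting[OF assms(2,3)] assms(4) that by auto
  let ?f = "\<lambda>(x, y). x \<otimes> y"
  have eq: "x = x' \<and> y = y'" if "x \<in> N" "y \<in> M" "x' \<in> N" "y' \<in> M" "x \<otimes> y = x' \<otimes> y'" for x y x' y'
  proof -
    have "inv x' \<otimes> x = y' \<otimes> inv y"
      using that by (metis M.mem_carrier N.mem_carrier inv_closed inv_solve_left' inv_solve_right m_assoc m_closed)
    moreover have "inv x' \<otimes> x \<in> N" "y' \<otimes> inv y \<in> M" using that by auto
    ultimately have "inv x' \<otimes> x = \<one>" "y' \<otimes> inv y = \<one>" using assms(4) by auto
    thus ?thesis using that
      by (metis M.mem_carrier N.mem_carrier inv_equality inv_inv inv_closed)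
  qed
  have "?f \<in> hom (subgrp G N \<times>\<times> subgrp G M) G"
  proof (rule homI)
    fix p q assume "p \<in> carrier (subgrp G N \<times>\<times> subgrp G M)" "q \<in> carrier (subgrp G N \<times>\<times> subgrp G M)"
    then obtain a b c d where *: "p = (a, b)" "q = (c, d)" "a \<in> N" "b \<in> M" "c \<in> N" "d \<in> M" by auto
    hence "(a \<otimes> c) \<otimes> (b \<otimes> d) = a \<otimes> (c \<otimes> b) \<otimes> d" by (simp add: m_assoc)
    also have "\<dots> = a \<otimes> (b \<otimes> c) \<otimes> d" using com * by simp
    also have "\<dots> = (a \<otimes> b) \<otimes> (c \<otimes> d)" using * by (simp add: m_assoc)
    finally show "?f (p \<otimes>\<^bsub>subgrp G N \<times>\<times> subgrp G M\<^esub> q) = ?f p \<otimes> ?f q" using * by simp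
  qed auto
  moreover have "inj_on ?f (N \<times> M)"
    using eq by (auto simp: inj_on_def)
  moreover have "?f ` (N \<times> M) = carrier G"
    unfolding assms(5)[symmetric] set_mult_def by auto
  ultimately show "subgrp G N \<times>\<times> subgrp G M \<cong> G"
    unfolding is_iso_def iso_def bij_betw_def mem_Collect_eq carrier_DirProd carrier_subgrp
    by blast
  have "G Mod N \<cong> subgrp G M Mod {\<one>}"
    using weak_snd_iso_thme[OF M.subgroup_axioms assms(2)] assms(4,5) by (simp add: subgrp_def)
  also have "\<dots> \<cong> subgrp G M" using Mod_one_iso[OF gM.is_group] by simp
  finally show "G Mod N \<cong> subgrp G M" .
qed

text \<open>Along each coordinate embedding a simple normal subgroup of a factor becomes a simple
  normal subgroup of the product, hence lies in \<open>M\<close>. So the preimages of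
  \<open>M\<close> are the full factors, and these generate the product.\<close>

lemma socle_generated_DirProd:
  assumes "group G" "group H" "socle_generated G" "socle_generated H"
  shows "socle_generated (G \<times>\<times> H)"
  unfolding socle_generated_def
proof (intro allI impI)
  fix M assume M: "M \<lhd> G \<times>\<times> H"
    and *: "\<forall>S. S \<lhd> G \<times>\<times> H \<longrightarrow> simple_group (subgrp (G \<times>\<times> H) S) \<longrightarrow> S \<subseteq> M"
  interpret G: group G by fact
  interpret H: group H by fact
  interpret P: group "G \<times>\<times> H" using assms(1,2) by (rule DirProd_group)
  interpret M: normal M "G \<times>\<times> H" by fact
  let ?f = "\<lambda>x. (x, \<one>\<^bsub>H\<^esub>)" and ?g = "\<lambda>y. (\<one>\<^bsub>G\<^esub>, y)"
  interpret f: group_hom G "G \<times>\<times> H" ?f by unfold_locales (auto simp: hom_def)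
  interpret g: group_hom H "G \<times>\<times> H" ?g by unfold_locales (auto simp: hom_def)
  \<comment> \<open>The type of \<open>K\<close> is left open because the claim is applied to both
    embeddings, whose domains have different types.\<close>
  have simp_img: "simple_group (subgrp (G \<times>\<times> H) (h ` S))"
    if "group_hom K (G \<times>\<times> H) h" "inj_on h S" "S \<lhd> K" "simple_group (subgrp K S)"
    for K :: "('z, 'w) monoid_scheme" and h S
    by (rule simple_group.iso_simple[OF that(4) _ iso_subgrp_image[OF that(1) _ that(2)]])
      (use that in \<open>auto intro!: group_subgrp P.is_group group_hom.subgroup_img_is_subgroup
         dest: normal_imp_subgroup\<close>)
  have "{x \<in> carrier G. ?f x \<in> M} = carrier G"
  proof (rule assms(3)[unfolded socle_generated_def, rule_format, OF normal_vimage[OF f.group_hom_axioms M]])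
    fix S assume S: "S \<lhd> G" "simple_group (subgrp G S)"
    have "?f ` S = S \<times> {\<one>\<^bsub>H\<^esub>}" by auto
    hence "?f ` S \<lhd> G \<times>\<times> H"
      using G.DirProd_normal[OF assms(2) S(1) H.one_is_normal] by simp
    moreover have "simple_group (subgrp (G \<times>\<times> H) (?f ` S))"
      using f.group_hom_axioms S by (intro simp_img) (auto simp: inj_on_def)
    ultimately have "?f ` S \<subseteq> M" using * by blast
    thus "S \<subseteq> {x \<in> carrier G. ?f x \<in> M}"
      using S(1) by (auto dest!: normal_imp_subgroup subgroup.subset)
  qed
  moreover have "{x \<in> carrier H. ?g x \<in> M} = carrier H"
  proof (rule assms(4)[unfolded socle_generated_def, rule_format, OF normal_vimage[OF g.group_hom_axioms M]])
    fix S assume S: "S \<lhd> H" "simple_group (subgrp H S)"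
    have "?g ` S = {\<one>\<^bsub>G\<^esub>} \<times> S" by auto
    hence "?g ` S \<lhd> G \<times>\<times> H"
      using G.DirProd_normal[OF assms(2) G.one_is_normal S(1)] by simp
    moreover have "simple_group (subgrp (G \<times>\<times> H) (?g ` S))"
      using g.group_hom_axioms S by (intro simp_img) (auto simp: inj_on_def)
    ultimately have "?g ` S \<subseteq> M" using * by blast
    thus "S \<subseteq> {x \<in> carrier H. ?g x \<in> M}"
      using S(1) by (auto dest!: normal_imp_subgroup subgroup.subset)
  qed
  ultimately have "(x, y) \<in> M" if "x \<in> carrier G" "y \<in> carrier H" for x y
    using M.m_closed[of "?f x" "?g y"] that by auto
  thus "M = carrier (G \<times>\<times> H)" using M.subset by auto
qed

text \<open>Here \<open>carrier G\<close> is itself one of the simple normal subgroups that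
  \<open>M\<close> has to contain.\<close>

lemma socle_generated_simple:
  assumes "simple_group G" shows "socle_generated G"
proof -
  interpret simple_group G by fact
  have "carrier G \<lhd> G" by (rule normal_invI) (auto intro: subgroup_self)
  show ?thesis
    unfolding socle_generated_def
  proof (intro allI impI equalityI)
    fix M assume "M \<lhd> G" "\<forall>S. S \<lhd> G \<longrightarrow> simple_group (subgrp G S) \<longrightarrow> S \<subseteq> M"
    thus "M \<subseteq> carrier G" "carrier G \<subseteq> M"
      using \<open>carrier G \<lhd> G\<close> assms by (auto dest: normal_imp_subgroup subgroup.mem_carrier)
  qed
qed

lemma socle_generated_trivial:
  assumes "group G" "carrier G = {\<one>\<^bsub>G\<^esub>}" shows "socle_generated G"
  unfolding socle_generated_def
proof (intro allI impI)
  fix M assume "M \<lhd> G"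
  hence "subgroup M G" by (rule normal_imp_subgroup)
  from subgroup.subset[OF this] subgroup.one_closed[OF this] show "M = carrier G"
    unfolding assms(2) by blast
qed

section \<open>Products of simple groups\<close>

text \<open>Splits off the last factor, which makes finite products accessible to induction on the
  number of factors.\<close>

lemma product_group_Suc_iso:
  "product_group {..<Suc k} S \<cong> product_group {..<k} S \<times>\<times> S k"
proof -
  let ?f = "\<lambda>x. (restrict x {..<k}, x k)"
  have "?f \<in> hom (product_group {..<Suc k} S) (product_group {..<k} S \<times>\<times> S k)"
  proof (rule homI)
    fix x assume "x \<in> carrier (product_group {..<Suc k} S)"
    thus "?f x \<in> carrier (product_group {..<k} S \<times>\<times> S k)"
      by (simp add: PiE_iff)
  next
    fix x y
    show "?f (x \<otimes>\<^bsub>product_group {..<Suc k} S\<^esub> y) = ?f x \<otimes>\<^bsub>product_group {..<k} S \<times>\<times> S k\<^esub> ?f y"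
      by (simp add: restrict_def fun_eq_iff)
  qed
  moreover have "bij_betw ?f (carrier (product_group {..<Suc k} S)) (carrier (product_group {..<k} S \<times>\<times> S k))"
  proof (rule bij_betw_byWitness[where f' = "\<lambda>(x, y). x(k := y)"]; (intro ballI subsetI)?)
    fix x assume "x \<in> carrier (product_group {..<Suc k} S)"
    \<comment> \<open>Elements of a product group are extensional functions. Their default value off
      the index set is what makes restriction and update mutually inverse.\<close>
    hence "x j = undefined" if "\<not> j < Suc k" for j
      using that by (simp add: PiE_iff extensional_def)
    thus "(\<lambda>(x, y). x(k := y)) (?f x) = x"
      by (auto simp: fun_eq_iff restrict_def)
  next
    fix p assume "p \<in> carrier (product_group {..<k} S \<times>\<times> S k)"
    then obtain x y where p: "p = (x, y)" "x \<in> carrier (product_group {..<k} S)" by auto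
    hence "x j = undefined" if "\<not> j < k" for j
      using that by (simp add: PiE_iff extensional_def)
    thus "?f ((\<lambda>(x, y). x(k := y)) p) = p"
      by (auto simp: p fun_eq_iff restrict_def)
  next
    fix p assume "p \<in> ?f ` carrier (product_group {..<Suc k} S)"
    then obtain x where "p = ?f x" "x \<in> carrier (product_group {..<Suc k} S)" by (rule imageE)
    thus "p \<in> carrier (product_group {..<k} S \<times>\<times> S k)"
      by (simp add: PiE_iff)
  next
    fix x assume "x \<in> (\<lambda>(x, y). x(k := y)) ` carrier (product_group {..<k} S \<times>\<times> S k)"
    then obtain z y where "x = z(k := y)" "z \<in> carrier (product_group {..<k} S)" "y \<in> carrier (S k)"
      unfolding carrier_DirProd by (elim imageE SigmaE) simp
    thus "x \<in> carrier (product_group {..<Suc k} S)"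
      by (simp add: PiE_iff extensional_def)
  qed
  ultimately show ?thesis by (auto simp: is_iso_def iso_def)
qed

lemma product_group_empty: "carrier (product_group {} S) = {\<one>\<^bsub>product_group {} S\<^esub>}"
  by (simp add: restrict_def fun_eq_iff)

lemma iso_trivial:
  assumes "group G" "group H" "carrier G = {\<one>\<^bsub>G\<^esub>}" "carrier H = {\<one>\<^bsub>H\<^esub>}"
  shows "G \<cong> H"
proof -
  have "(\<lambda>_. \<one>\<^bsub>H\<^esub>) \<in> iso G H"
    using assms by (auto simp: iso_def hom_def bij_betw_def group.is_monoid)
  thus ?thesis by (auto simp: is_iso_def)
qed

lemma product_of_simple_groups_iso:
  assumes "group G" "G \<cong> H" "product_of_simple_groups G"
  shows "product_of_simple_groups H"
  using assms group.iso_sym iso_trans unfolding product_of_simple_groups_def by metis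

text \<open>Induction on the number of factors. The predicate \<open>P\<close> has one fixed type,
  whereas \<open>T \<times>\<times> S\<close> has elements of another type than \<open>T\<close>;
  therefore the step speaks of a group \<open>K\<close> of the fixed type that is isomorphic to the
  product.\<close>

lemma product_of_simple_groups_iso_induct:
  assumes "product_of_simple_groups G" "group G"
    and triv: "\<And>T :: (nat \<Rightarrow> nat) monoid. group T \<Longrightarrow> carrier T = {\<one>\<^bsub>T\<^esub>} \<Longrightarrow> P T"
    and step: "\<And>(T :: (nat \<Rightarrow> nat) monoid) (S :: nat monoid) (K :: (nat \<Rightarrow> nat) monoid).
      group T \<Longrightarrow> finite (carrier T) \<Longrightarrow> P T \<Longrightarrow> simple_group S \<Longrightarrow> finite (carrier S) \<Longrightarrow>
      group K \<Longrightarrow> K \<cong> T \<times>\<times> S \<Longrightarrow> P K"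
  obtains T where "group T" "G \<cong> T" "P T"
proof -
  obtain k and S :: "nat \<Rightarrow> nat monoid" where S: "\<And>j. j < k \<Longrightarrow> simple_group (S j) \<and> finite (carrier (S j))"
    and G: "G \<cong> product_group {..<k} S"
    using assms(1) unfolding product_of_simple_groups_def by blast
  have gr: "group (product_group {..<i} S)" if "i \<le> k" for i
    using S that by (intro product_group) (auto simp: simple_group_def)
  have "P (product_group {..<i} S)" if "i \<le> k" for i
    using that
  proof (induction i)
    case 0
    show ?case
      using gr[of 0] product_group_empty[of S] by (intro triv) auto
  next
    case (Suc i)
    have fin: "finite (carrier (product_group {..<i} S))"
      using S Suc.prems by (auto intro!: finite_PiE)
    show ?case
      using Suc S[of i] gr
      by (intro step[of "product_group {..<i} S" "S i", OF _ fin _ _ _ _ product_group_Suc_iso]) auto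
  qed
  thus ?thesis using that[of "product_group {..<k} S"] G gr by auto
qed

lemma product_of_simple_groups_step:
  fixes S :: "nat monoid"
  assumes "group G" "product_of_simple_groups G" "simple_group S" "finite (carrier S)"
  shows "product_of_simple_groups (G \<times>\<times> S)"
proof -
  obtain k and R :: "nat \<Rightarrow> nat monoid" where R: "\<forall>j<k. simple_group (R j) \<and> finite (carrier (R j))"
    and G: "G \<cong> product_group {..<k} R"
    using assms(2) unfolding product_of_simple_groups_def by blast
  \<comment> \<open>The new factor is placed at index \<open>k\<close>, outside
    \<open>{..<k}\<close>, so the product of the old factors does not change.\<close>
  let ?R = "R(k := S)"
  have "product_group {..<k} R = product_group {..<k} ?R"
  proof -
    have "(\<Pi>\<^sub>E i\<in>{..<k}. carrier (R i)) = (\<Pi>\<^sub>E i\<in>{..<k}. carrier (?R i))"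
      by (rule PiE_cong) simp
    thus ?thesis unfolding product_group_def by (simp cong: restrict_cong)
  qed
  with G have "G \<cong> product_group {..<k} ?R" by simp
  hence "G \<times>\<times> S \<cong> product_group {..<k} ?R \<times>\<times> ?R k"
    using group.DirProd_iso_trans[OF assms(1) _ iso_refl[of S]] by simp
  moreover have grp: "group (product_group {..<Suc k} ?R)"
    using R assms(3) by (intro product_group) (auto simp: simple_group_def)
  hence "product_group {..<k} ?R \<times>\<times> ?R k \<cong> product_group {..<Suc k} ?R"
    by (rule group.iso_sym[OF _ product_group_Suc_iso])
  ultimately have "G \<times>\<times> S \<cong> product_group {..<Suc k} ?R" by (rule iso_trans)
  thus ?thesis
    unfolding product_of_simple_groups_def
    using R assms(3,4) by (intro exI[of _ "Suc k"] exI[of _ ?R]) (auto simp: less_Suc_eq)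
qed

lemma product_of_simple_groups_imp_socle_generated:
  assumes "product_of_simple_groups G" "group G"
  shows "socle_generated G"
proof (rule product_of_simple_groups_iso_induct[OF assms, where P = socle_generated])
  show "socle_generated T" if "group T" "carrier T = {\<one>\<^bsub>T\<^esub>}" for T :: "(nat \<Rightarrow> nat) monoid"
    using that by (rule socle_generated_trivial)
  fix T K :: "(nat \<Rightarrow> nat) monoid" and S :: "nat monoid"
  assume "group T" "socle_generated T" "simple_group S" "group K" "K \<cong> T \<times>\<times> S"
  thus "socle_generated K"
    by (meson DirProd_group group.iso_sym simple_group_def socle_generated_DirProd
        socle_generated_iso socle_generated_simple)
next
  fix T :: "(nat \<Rightarrow> nat) monoid"
  assume "group T" "G \<cong> T" "socle_generated T"
  thus "socle_generated G" using assms(2) group.iso_sym socle_generated_iso by blast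
qed

text \<open>Induction on the order. A simple normal subgroup \<open>S\<close> has a normal
  complement \<open>M\<close>, which is isomorphic to \<open>G Mod S\<close>, inherits the criterion
  and is smaller. Then \<open>G\<close> is isomorphic to the product of \<open>M\<close> and
  \<open>S\<close>.\<close>

lemma socle_generated_imp_product_of_simple_groups:
  assumes "group G" "finite (carrier G)" "socle_generated G"
  shows "product_of_simple_groups G"
  using assms
proof (induction "card (carrier G)" arbitrary: G rule: less_induct)
  case less
  interpret group G by fact
  show ?case
  proof (cases "\<exists>S. S \<lhd> G \<and> simple_group (subgrp G S)")
    case False
    \<comment> \<open>Without simple normal subgroups the trivial subgroup contains all of them
      vacuously, so the criterion forces \<open>G\<close> to be trivial. It is then the empty
      product.\<close>
    hence "carrier G = {\<one>\<^bsub>G\<^esub>}"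
      using less.prems(3) one_is_normal unfolding socle_generated_def by metis
    moreover let ?T = "product_group {} (undefined :: nat \<Rightarrow> nat monoid)"
    have "group ?T" by (rule product_group) simp
    moreover have "product_of_simple_groups ?T"
      unfolding product_of_simple_groups_def by (intro exI[of _ 0] exI[of _ undefined]) simp
    ultimately show ?thesis
      using product_of_simple_groups_iso iso_trivial[OF _ is_group product_group_empty] by blast
  next
    case True
    then obtain S where S: "S \<lhd> G" "simple_group (subgrp G S)" by auto
    interpret S: normal S G by fact
    interpret S': simple_group "subgrp G S" by fact
    obtain M where M: "M \<lhd> G" "S \<inter> M = {\<one>\<^bsub>G\<^esub>}" "S <#>\<^bsub>G\<^esub> M = carrier G"
      using socle_generated_complement[OF less.prems S(1)] .
    note iso = normal_complement_iso[OF is_group S(1) M]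
    interpret M: normal M G by fact
    have gM: "group (subgrp G M)" using is_group M.subgroup_axioms by (rule group_subgrp)
    have finS: "finite S" and finM: "finite M"
      using less.prems(2) M.subset S.subset finite_subset by blast+
    have "socle_generated (G Mod S)"
      by (rule socle_generated_epi[OF is_group group_Mod epi_Mod less.prems(3)]) fact+
    hence "socle_generated (subgrp G M)"
      by (rule socle_generated_iso[OF group_Mod[OF S(1)] gM iso(2)])
    moreover have "M \<noteq> carrier G"
    proof
      assume "M = carrier G"
      hence "S = {\<one>\<^bsub>G\<^esub>}" using M(2) S.subset by auto
      thus False using S'.simple_not_triv by simp
    qed
    hence "card M < card (carrier G)"
      using M.subset less.prems(2) by (intro psubset_card_mono) auto
    ultimately have psM: "product_of_simple_groups (subgrp G M)"
      using less.hyps[of "subgrp G M"] finM gM by simp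
    \<comment> \<open>The factors in \<open>product_of_simple_groups\<close> are groups of natural
      numbers.\<close>
    let ?S = "nat_copy (subgrp G S)"
    have cp: "group ?S" "subgrp G S \<cong> ?S" using S'.is_group finS by (auto intro!: nat_copy)
    have "simple_group ?S"
      using cp S'.iso_simple unfolding is_iso_def by blast
    hence "product_of_simple_groups (subgrp G M \<times>\<times> ?S)"
      using finS by (intro product_of_simple_groups_step gM psM) (auto intro: finite_iso[OF cp(2)])
    moreover have "subgrp G M \<times>\<times> ?S \<cong> subgrp G M \<times>\<times> subgrp G S"
      by (intro group.DirProd_iso_trans gM iso_refl group.iso_sym[OF _ cp(2)] S'.is_group)
    hence "subgrp G M \<times>\<times> ?S \<cong> G"
      using iso_trans[OF _ iso_trans[OF DirProd_commute_iso iso(1)]] by blast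
    ultimately show ?thesis
      using product_of_simple_groups_iso[OF DirProd_group[OF gM cp(1)]] by blast
  qed
qed

lemma product_of_simple_groups_iff:
  assumes "group G" "finite (carrier G)"
  shows "product_of_simple_groups G \<longleftrightarrow> socle_generated G"
  using assms product_of_simple_groups_imp_socle_generated
    socle_generated_imp_product_of_simple_groups by blast

lemma product_of_simple_groups_epi:
  assumes "group G" "finite (carrier G)" "group H" "f \<in> epi G H" "product_of_simple_groups G"
  shows "product_of_simple_groups H"
proof -
  have "finite (carrier H)" using assms(2,4) by (auto simp: epi_def dest: sym)
  thus ?thesis
    using assms socle_generated_epi by (auto simp: product_of_simple_groups_iff)
qed

text \<open>For a normal complement \<open>M\<close> the group \<open>N\<close> is isomorphic to
  \<open>G Mod M\<close>, so closure under quotients applies. For this the complement relation is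
  read with \<open>N\<close> and \<open>M\<close> exchanged.\<close>

lemma product_of_simple_groups_normal:
  assumes "group G" "finite (carrier G)" "N \<lhd> G" "product_of_simple_groups G"
  shows "product_of_simple_groups (subgrp G N)"
proof -
  have "socle_generated G" using assms by (simp add: product_of_simple_groups_iff)
  from socle_generated_complement[OF assms(1,2) this assms(3)]
  obtain M where M: "M \<lhd> G" "N \<inter> M = {\<one>\<^bsub>G\<^esub>}" "N <#>\<^bsub>G\<^esub> M = carrier G" .
  have "M \<inter> N = {\<one>\<^bsub>G\<^esub>}" "M <#>\<^bsub>G\<^esub> N = carrier G"
    using M assms(3) group.commut_normal[OF assms(1) normal_imp_subgroup, of M N]
    by (auto dest: normal_imp_subgroup)
  hence "G Mod M \<cong> subgrp G N"
    using normal_complement_iso(2)[OF assms(1) M(1) assms(3)] by blast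
  moreover have "product_of_simple_groups (G Mod M)"
    using assms by (intro product_of_simple_groups_epi[OF _ _ _ epi_Mod] group_Mod M(1))
  ultimately show ?thesis
    using product_of_simple_groups_iso group_Mod[OF M(1)] by blast
qed

lemma product_of_simple_groups_DirProd:
  assumes "group G" "finite (carrier G)" "group H" "finite (carrier H)"
    "product_of_simple_groups G" "product_of_simple_groups H"
  shows "product_of_simple_groups (G \<times>\<times> H)"
  using assms by (simp add: product_of_simple_groups_iff DirProd_group socle_generated_DirProd)

lemma product_of_simple_groups_simple:
  assumes "simple_group G" "finite (carrier G)"
  shows "product_of_simple_groups G"
  using assms socle_generated_simple
  by (simp add: product_of_simple_groups_iff simple_group_def)

section \<open>Factor groups under images, preimages and intersections\<close>

lemma normal_imp_group: "N \<lhd> G \<Longrightarrow> group G"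
  by (simp add: normal_def)

lemma rcos_eq_iff:
  assumes "N \<lhd> G" "x \<in> carrier G"
  shows "N #>\<^bsub>G\<^esub> x = N \<longleftrightarrow> x \<in> N"
proof -
  interpret N: normal N G by fact
  show ?thesis
    using N.coset_join1[OF _ assms(2) N.subgroup_axioms] N.rcos_const[OF N.is_group] by blast
qed

lemma kernel_Mod:
  assumes "N \<lhd> G" shows "kernel G (G Mod N) (\<lambda>x. N #>\<^bsub>G\<^esub> x) = N"
proof -
  interpret N: normal N G by fact
  show ?thesis using rcos_eq_iff[OF assms] N.subset by (auto simp: kernel_def)
qed

text \<open>The map \<open>f\<close> induces an epimorphism from \<open>A Mod N\<close> onto
  \<open>B Mod M\<close>. This treats the factors of an image series.\<close>

lemma product_of_simple_groups_Mod_epi: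
  assumes "finite (carrier A)" "N \<lhd> A" "M \<lhd> B" "f \<in> epi A B" "f ` N \<subseteq> M"
    and psg: "product_of_simple_groups (A Mod N)"
  shows "product_of_simple_groups (B Mod M)"
proof -
  have grp: "group A" "group B" using assms by (auto dest: normal_imp_group)
  interpret N: normal N A by fact
  interpret M: normal M B by fact
  interpret f: group_hom A B f using grp assms(4) by (rule epi_group_hom)
  let ?h = "\<lambda>x. M #>\<^bsub>B\<^esub> f x"
  have h: "?h \<in> epi A (B Mod M)"
    using assms(4) epi_Mod[OF assms(3)]
    by (auto simp: epi_def hom_def carrier_FactGroup image_image[of _ f, symmetric] simp del: image_image)
  interpret h: group_hom A "B Mod M" ?h
    by (rule epi_group_hom[OF grp(1) group_Mod[OF assms(3)] h])
  have "?h x = M" if "x \<in> N" for x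
    using that assms(5) by (intro M.rcos_const) auto
  hence "N \<subseteq> kernel A (B Mod M) ?h"
    by (auto simp: kernel_def)
  from h.FactGroup_universal_kernel[OF assms(2) this] obtain g where
    g: "g \<in> hom (A Mod N) (B Mod M)" "\<And>x. x \<in> carrier A \<Longrightarrow> g (N #>\<^bsub>A\<^esub> x) = ?h x" by metis
  have "g ` carrier (A Mod N) = ?h ` carrier A"
    using g(2) by (auto simp: carrier_FactGroup image_image cong: image_cong)
  hence "g \<in> epi (A Mod N) (B Mod M)" using g(1) h by (simp add: epi_def)
  from product_of_simple_groups_epi[OF _ _ _ this psg] show ?thesis
    by (simp add: group_Mod finite_Mod assms)
qed

text \<open>By the first isomorphism theorem. The kernel enters through an equation so that
  \<open>N\<close> may be any convenient description of it.\<close>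

lemma product_of_simple_groups_Mod_kernel:
  assumes "group A" "group B" "f \<in> epi A B" "kernel A B f = N" "product_of_simple_groups B"
  shows "product_of_simple_groups (A Mod N)"
proof -
  have "N \<lhd> A"
    using group_hom.normal_kernel[OF epi_group_hom[OF assms(1-3)]] assms(4) by simp
  hence "B \<cong> A Mod N"
    using group.iso_sym[OF group_Mod] Mod_kernel_iso[OF assms(1-3)] assms(4) by blast
  thus ?thesis using product_of_simple_groups_iso assms(2,5) by blast
qed

text \<open>The quotient is isomorphic to the image of \<open>H\<close> in \<open>G Mod N\<close>,
  which is a normal subgroup of a product of simple groups.\<close>

lemma product_of_simple_groups_Mod_normal:
  assumes "finite (carrier G)" "N \<lhd> G" "H \<lhd> G" "product_of_simple_groups (G Mod N)"
  shows "product_of_simple_groups (subgrp G H Mod (N \<inter> H))"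
proof -
  interpret N: normal N G by fact
  interpret H: normal H G by fact
  let ?f = "\<lambda>x. N #>\<^bsub>G\<^esub> x" and ?I = "(\<lambda>x. N #>\<^bsub>G\<^esub> x) ` H"
  interpret f: group_hom G "G Mod N" ?f
    by (rule epi_group_hom[OF N.is_group group_Mod epi_Mod]) fact+
  have I: "?I \<lhd> G Mod N"
    using epi_Mod[OF assms(2)] by (intro H.surj_hom_normal_subgroup f.group_hom_axioms) (simp add: epi_def)
  have gI: "group (subgrp (G Mod N) ?I)"
    by (intro group_subgrp f.H.is_group normal_imp_subgroup I)
  have f: "?f \<in> epi (subgrp G H) (subgrp (G Mod N) ?I)"
    using H.subset N.r_coset_hom_Mod by (auto simp: epi_def hom_def subset_iff)
  have "?f x = N \<longleftrightarrow> x \<in> N" if "x \<in> H" for x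
    using that H.subset by (intro rcos_eq_iff assms(2)) auto
  hence "kernel (subgrp G H) (subgrp (G Mod N) ?I) ?f = N \<inter> H"
    by (auto simp: kernel_def)
  moreover have "product_of_simple_groups (subgrp (G Mod N) ?I)"
    using I assms f.H.is_group by (intro product_of_simple_groups_normal finite_Mod)
  ultimately show ?thesis
    by (intro product_of_simple_groups_Mod_kernel[OF _ gI f])
      (simp_all add: group_subgrp N.is_group H.subgroup_axioms)
qed

lemma product_of_simple_groups_trivial:
  assumes "group G" "carrier G = {\<one>\<^bsub>G\<^esub>}" shows "product_of_simple_groups G"
  using assms by (simp add: product_of_simple_groups_iff socle_generated_trivial)

section \<open>Series whose factors are products of simple groups\<close>

text \<open>Descends from \<open>V n = carrier G\<close>, since each \<open>V i\<close> is a
  subgroup of the next term.\<close>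

lemma subnormal_series_subgroup:
  assumes "group G" "subnormal_series G n V" "i \<le> n"
  shows "subgroup (V i) G"
  using assms(3)
proof (induction rule: inc_induct)
  case base
  show ?case using assms by (simp add: subnormal_series_def group.subgroup_self)
next
  case (step i)
  thus ?case using assms by (auto simp: subnormal_series_def normal_subgrp_iff)
qed

text \<open>The condition minimized in \<open>mu\<close>. Closure properties are proved for a fixed
  length \<open>l\<close>, before minimality enters.\<close>

definition has_series :: "('a, 'b) monoid_scheme \<Rightarrow> nat \<Rightarrow> bool" where
  "has_series G l \<longleftrightarrow> (\<exists>V. subnormal_series G l V \<and>
     (\<forall>i<l. product_of_simple_groups (subgrp G (V (Suc i)) Mod V i)))"

lemma has_seriesI:
  assumes "V 0 = {\<one>\<^bsub>G\<^esub>}" "V l = carrier G"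
    "\<And>i. i < l \<Longrightarrow> V i \<lhd> subgrp G (V (Suc i))"
    "\<And>i. i < l \<Longrightarrow> product_of_simple_groups (subgrp G (V (Suc i)) Mod V i)"
  shows "has_series G l"
  using assms by (auto simp: has_series_def subnormal_series_def)

lemma has_seriesE:
  assumes "has_series G l" "group G"
  obtains V where "V 0 = {\<one>\<^bsub>G\<^esub>}" "V l = carrier G"
    "\<And>i. i < l \<Longrightarrow> V i \<lhd> subgrp G (V (Suc i))"
    "\<And>i. i < l \<Longrightarrow> product_of_simple_groups (subgrp G (V (Suc i)) Mod V i)"
    "\<And>i. i \<le> l \<Longrightarrow> subgroup (V i) G"
proof -
  obtain V where V: "subnormal_series G l V"
    "\<forall>i<l. product_of_simple_groups (subgrp G (V (Suc i)) Mod V i)"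
    using assms(1) by (auto simp: has_series_def)
  show ?thesis
    using V subnormal_series_subgroup[OF assms(2) V(1)]
    by (intro that[of V]) (auto simp: subnormal_series_def)
qed

lemma has_series_0: "carrier G = {\<one>\<^bsub>G\<^esub>} \<Longrightarrow> has_series G 0"
  by (rule has_seriesI[of "\<lambda>_. carrier G"]) auto

lemma has_series_1:
  assumes "group G" "product_of_simple_groups G"
  shows "has_series G 1"
proof (rule has_seriesI[of "\<lambda>i. if i = 0 then {\<one>\<^bsub>G\<^esub>} else carrier G"])
  interpret group G by fact
  have "product_of_simple_groups (G Mod {\<one>\<^bsub>G\<^esub>})"
    using group.iso_sym[OF group_Mod[OF one_is_normal] Mod_one_iso[OF assms(1)]] assms
      product_of_simple_groups_iso by blast
  thus "product_of_simple_groups (subgrp G (if Suc i = 0 then {\<one>\<^bsub>G\<^esub>} else carrier G) Mod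
     (if i = 0 then {\<one>\<^bsub>G\<^esub>} else carrier G))" if "i < 1" for i
    using that by simp
qed (use group.one_is_normal[OF assms(1)] in auto)

text \<open>Every term is intersected with \<open>N\<close>. Since
  \<open>N \<inter> V (Suc i)\<close> is normal in \<open>V (Suc i)\<close>, the new factor embeds
  as a normal subgroup of the old one.\<close>

lemma has_series_normal:
  assumes "group G" "finite (carrier G)" "N \<lhd> G" "has_series G l"
  shows "has_series (subgrp G N) l"
proof -
  from has_seriesE[OF assms(4,1)] obtain V where
    V: "V 0 = {\<one>\<^bsub>G\<^esub>}" "V l = carrier G"
    "\<And>i. i < l \<Longrightarrow> V i \<lhd> subgrp G (V (Suc i))"
    "\<And>i. i < l \<Longrightarrow> product_of_simple_groups (subgrp G (V (Suc i)) Mod V i)"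
    and sub: "\<And>i. i \<le> l \<Longrightarrow> subgroup (V i) G" by blast
  interpret N: normal N G by fact
  show ?thesis
  proof (rule has_seriesI[of "\<lambda>i. N \<inter> V i"])
    show "N \<inter> V 0 = {\<one>\<^bsub>subgrp G N\<^esub>}" "N \<inter> V l = carrier (subgrp G N)"
      using N.subset N.one_closed V by auto
    fix i assume i: "i < l"
    let ?A = "subgrp G (V (Suc i))"
    have gA: "group ?A" using assms(1) sub[of "Suc i"] i by (simp add: group_subgrp)
    have H: "N \<inter> V (Suc i) \<lhd> ?A"
      using assms(1,3) sub[of "Suc i"] i by (simp add: normal_restrict)
    have sub': "V i \<subseteq> V (Suc i)"
      using subgroup.subset[OF normal_imp_subgroup[OF V(3)[OF i]]] by simp
    hence eq: "V i \<inter> (N \<inter> V (Suc i)) = N \<inter> V i" by auto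
    from normal_restrict[OF gA V(3)[OF i] normal_imp_subgroup[OF H]]
    show "N \<inter> V i \<lhd> subgrp (subgrp G N) (N \<inter> V (Suc i))"
      unfolding eq by simp
    have "finite (carrier ?A)"
      using subgroup.subset[OF sub[of "Suc i"]] i assms(2) by (auto intro: finite_subset)
    from product_of_simple_groups_Mod_normal[OF this V(3)[OF i] H V(4)[OF i]]
    show "product_of_simple_groups (subgrp (subgrp G N) (N \<inter> V (Suc i)) Mod (N \<inter> V i))"
      unfolding eq by simp
  qed
qed

lemma epi_subgrp_image:
  assumes "group_hom G H f" "subgroup S G"
  shows "f \<in> epi (subgrp G S) (subgrp H (f ` S))"
proof -
  interpret f: group_hom G H f by fact
  interpret S: subgroup S G by fact
  show ?thesis by (auto simp: epi_def hom_def)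
qed

text \<open>The images of the terms form a series whose factors are quotients of the old factors.
  Some terms may coincide, which the definition permits, so the length is kept.\<close>

lemma has_series_epi:
  assumes "group G" "finite (carrier G)" "group H" "f \<in> epi G H" "has_series G l"
  shows "has_series H l"
proof -
  from has_seriesE[OF assms(5,1)] obtain V where
    V: "V 0 = {\<one>\<^bsub>G\<^esub>}" "V l = carrier G"
    "\<And>i. i < l \<Longrightarrow> V i \<lhd> subgrp G (V (Suc i))"
    "\<And>i. i < l \<Longrightarrow> product_of_simple_groups (subgrp G (V (Suc i)) Mod V i)"
    and sub: "\<And>i. i \<le> l \<Longrightarrow> subgroup (V i) G" by blast
  interpret f: group_hom G H f using assms(1,3,4) by (rule epi_group_hom)
  show ?thesis
  proof (rule has_seriesI[of "\<lambda>i. f ` V i"])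
    show "f ` V 0 = {\<one>\<^bsub>H\<^esub>}" "f ` V l = carrier H"
      using V assms(4) by (auto simp: epi_def)
    fix i assume i: "i < l"
    let ?A = "subgrp G (V (Suc i))" and ?B = "subgrp H (f ` V (Suc i))"
    have S: "subgroup (V (Suc i)) G" using sub i by simp
    have gA: "group ?A" using assms(1) S by (simp add: group_subgrp)
    have gB: "group ?B" using f.H.is_group f.subgroup_img_is_subgroup[OF S] by (rule group_subgrp)
    have f: "f \<in> epi ?A ?B" using f.group_hom_axioms S by (rule epi_subgrp_image)
    interpret f': group_hom ?A ?B f using gA gB f by (rule epi_group_hom)
    show n: "f ` V i \<lhd> ?B"
      by (rule normal.surj_hom_normal_subgroup[OF V(3)[OF i] f'.group_hom_axioms]) simp
    have "finite (carrier ?A)"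
      using subgroup.subset[OF S] assms(2) by (auto intro: finite_subset)
    from product_of_simple_groups_Mod_epi[OF this V(3)[OF i] n f _ V(4)[OF i]]
    show "product_of_simple_groups (?B Mod f ` V i)" by simp
  qed
qed

lemma has_series_iso:
  assumes "group G" "finite (carrier G)" "group H" "G \<cong> H"
  shows "has_series G l \<longleftrightarrow> has_series H l"
proof -
  have "H \<cong> G" "finite (carrier H)" using assms group.iso_sym finite_iso by blast+
  then obtain f g where "f \<in> iso G H" "g \<in> iso H G" using assms(4) unfolding is_iso_def by blast
  thus ?thesis
    using has_series_epi[OF assms(1-3) iso_imp_epi]
      has_series_epi[OF assms(3) \<open>finite (carrier H)\<close> assms(1) iso_imp_epi] by blast
qed

text \<open>A series of the kernel is continued by the preimages of a series of \<open>H\<close>.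
  The upper factors are isomorphic to those of \<open>H\<close>.\<close>

lemma has_series_extension:
  assumes "group G" "group H" "f \<in> epi G H"
    and K: "has_series (subgrp G (kernel G H f)) a" and H: "has_series H b"
  shows "has_series G (a + b)"
proof -
  interpret f: group_hom G H f using assms(1,2,3) by (rule epi_group_hom)
  let ?K = "kernel G H f"
  have gK: "group (subgrp G ?K)" by (simp add: group_subgrp assms(1) f.subgroup_kernel)
  from has_seriesE[OF K gK] obtain U where
    U: "U 0 = {\<one>\<^bsub>subgrp G ?K\<^esub>}" "U a = carrier (subgrp G ?K)"
    "\<And>i. i < a \<Longrightarrow> U i \<lhd> subgrp (subgrp G ?K) (U (Suc i))"
    "\<And>i. i < a \<Longrightarrow> product_of_simple_groups (subgrp (subgrp G ?K) (U (Suc i)) Mod U i)"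
    "\<And>i. i \<le> a \<Longrightarrow> subgroup (U i) (subgrp G ?K)"
    by blast
  from has_seriesE[OF H assms(2)] obtain W where
    W: "W 0 = {\<one>\<^bsub>H\<^esub>}" "W b = carrier H"
    "\<And>i. i < b \<Longrightarrow> W i \<lhd> subgrp H (W (Suc i))"
    "\<And>i. i < b \<Longrightarrow> product_of_simple_groups (subgrp H (W (Suc i)) Mod W i)"
    and subW: "\<And>i. i \<le> b \<Longrightarrow> subgroup (W i) H" by blast
  define P where "P j = {x \<in> carrier G. f x \<in> W j}" for j
  have P0: "P 0 = ?K" by (auto simp: P_def W kernel_def)
  have Pb: "P b = carrier G" by (auto simp: P_def W)
  have subP: "subgroup (P j) G" if "j \<le> b" for j
  proof -
    interpret W: subgroup "W j" H using subW that by simp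
    show ?thesis by (auto simp: P_def intro!: subgroup.intro)
  qed
  have step: "P j \<lhd> subgrp G (P (Suc j)) \<and> product_of_simple_groups (subgrp G (P (Suc j)) Mod P j)"
    if j: "j < b" for j
  proof -
    let ?A = "subgrp G (P (Suc j))" and ?B = "subgrp H (W (Suc j))"
    have gA: "group ?A" using assms(1) subP j by (simp add: group_subgrp)
    have gB: "group ?B" using assms(2) subW j by (simp add: group_subgrp)
    have "f ` P (Suc j) = W (Suc j)"
      using subgroup.subset[OF subW[of "Suc j"]] j assms(3) by (auto simp: P_def epi_def)
    moreover have "f \<in> epi ?A (subgrp H (f ` P (Suc j)))"
      using subP j by (intro epi_subgrp_image f.group_hom_axioms) simp
    ultimately have f: "f \<in> epi ?A ?B" by simp
    interpret f': group_hom ?A ?B f using gA gB f by (rule epi_group_hom)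
    interpret W: normal "W j" ?B using W(3)[OF j] .
    have "W j \<subseteq> W (Suc j)" using W.subset by simp
    hence eq: "{x \<in> carrier ?A. f x \<in> W j} = P j" by (auto simp: P_def)
    have n: "P j \<lhd> ?A"
      using normal_vimage[OF f'.group_hom_axioms W(3)[OF j]] unfolding eq .
    let ?h = "\<lambda>x. W j #>\<^bsub>?B\<^esub> x"
    \<comment> \<open>Composing with the quotient map exhibits \<open>P j\<close> as a kernel, so
      \<open>?A Mod P j\<close> is isomorphic to \<open>?B Mod W j\<close>.\<close>
    have h: "?h \<circ> f \<in> epi ?A (?B Mod W j)"
      using f epi_Mod[OF W(3)[OF j]] by (rule epi_compose)
    have "?h y = W j \<longleftrightarrow> y \<in> W j" if "y \<in> W (Suc j)" for y
      using that by (intro rcos_eq_iff W(3) j) simp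
    hence "kernel ?A (?B Mod W j) (?h \<circ> f) = P j"
      using f by (auto simp: kernel_def P_def epi_def dest: subsetD[OF \<open>W j \<subseteq> W (Suc j)\<close>])
    from product_of_simple_groups_Mod_kernel[OF gA group_Mod[OF W(3)[OF j]] h this W(4)[OF j]] n
    show ?thesis by simp
  qed
  \<comment> \<open>The two series meet at index \<open>a\<close>, where \<open>U a\<close> and
    \<open>P 0\<close> are both the kernel. Hence \<open>V i = U i\<close> holds up to and including
    \<open>a\<close>, as the last step below \<open>a\<close> requires.\<close>
  define V where "V i = (if i < a then U i else P (i - a))" for i
  have V_le: "V i = U i" if "i \<le> a" for i
    using that U(2) P0 by (cases "i = a") (auto simp: V_def)
  have V_ge: "V (a + j) = P j" for j by (simp add: V_def)
  have "V i \<lhd> subgrp G (V (Suc i)) \<and> product_of_simple_groups (subgrp G (V (Suc i)) Mod V i)"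
    if "i < a + b" for i
  proof (cases "i < a")
    case True
    thus ?thesis using U(3)[of i] U(4)[of i] by (simp add: V_le)
  next
    case False
    hence "i = a + (i - a)" "i - a < b" using that by auto
    then obtain j where "i = a + j" "j < b" by blast
    thus ?thesis using step[of j] V_ge[of j] V_ge[of "Suc j"] by simp
  qed
  thus ?thesis
    using V_le[of 0] V_ge[of b] U(1) Pb by (intro has_seriesI[of V]) auto
qed

lemma has_series_extension_normal:
  assumes "N \<lhd> G" "has_series (subgrp G N) a" "has_series (G Mod N) b"
  shows "has_series G (a + b)"
  using has_series_extension[OF normal_imp_group[OF assms(1)] group_Mod[OF assms(1)]
      epi_Mod[OF assms(1)]] assms
  by (simp add: kernel_Mod)

text \<open>The trivial quotient \<open>G Mod carrier G\<close> is an empty product of simple groups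
  and adds one step. This allows series of two groups to be brought to a common length.\<close>

lemma has_series_mono:
  assumes "group G" "has_series G l" "l \<le> m"
  shows "has_series G m"
  using assms(3)
proof (induction rule: dec_induct)
  case base show ?case by fact
next
  case (step n)
  interpret group G by fact
  have n: "carrier G \<lhd> G" by (rule normal_invI) (auto intro: subgroup_self)
  have "carrier (G Mod carrier G) = {carrier G}"
    using coset_join2[OF _ subgroup_self] one_closed unfolding carrier_FactGroup by force
  hence "has_series (G Mod carrier G) 1"
    using n group_Mod[OF n] by (intro has_series_1 product_of_simple_groups_trivial) auto
  from has_series_extension_normal[OF n _ this] step.IH show ?case by simp
qed

lemma subgrp_DirProd: "subgrp (G \<times>\<times> H) (A \<times> B) = subgrp G A \<times>\<times> subgrp H B"
  by (simp add: subgrp_def DirProd_def)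

text \<open>The termwise products form a series, with the products of the corresponding factors as
  its factors.\<close>

lemma has_series_DirProd:
  assumes "group G" "finite (carrier G)" "group H" "finite (carrier H)" "has_series G l" "has_series H l"
  shows "has_series (G \<times>\<times> H) l"
proof -
  from has_seriesE[OF assms(5,1)] obtain V where
    V: "V 0 = {\<one>\<^bsub>G\<^esub>}" "V l = carrier G"
    "\<And>i. i < l \<Longrightarrow> V i \<lhd> subgrp G (V (Suc i))"
    "\<And>i. i < l \<Longrightarrow> product_of_simple_groups (subgrp G (V (Suc i)) Mod V i)"
    and subV: "\<And>i. i \<le> l \<Longrightarrow> subgroup (V i) G" by blast
  from has_seriesE[OF assms(6,3)] obtain W where
    W: "W 0 = {\<one>\<^bsub>H\<^esub>}" "W l = carrier H"
    "\<And>i. i < l \<Longrightarrow> W i \<lhd> subgrp H (W (Suc i))"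
    "\<And>i. i < l \<Longrightarrow> product_of_simple_groups (subgrp H (W (Suc i)) Mod W i)"
    and subW: "\<And>i. i \<le> l \<Longrightarrow> subgroup (W i) H" by blast
  show ?thesis
  proof (rule has_seriesI[of "\<lambda>i. V i \<times> W i"])
    show "V 0 \<times> W 0 = {\<one>\<^bsub>G \<times>\<times> H\<^esub>}" "V l \<times> W l = carrier (G \<times>\<times> H)"
      using V W by auto
    fix i assume i: "i < l"
    let ?A = "subgrp G (V (Suc i))" and ?B = "subgrp H (W (Suc i))"
    have gA: "group ?A" using assms(1) subV i by (simp add: group_subgrp)
    have gB: "group ?B" using assms(3) subW i by (simp add: group_subgrp)
    show "V i \<times> W i \<lhd> subgrp (G \<times>\<times> H) (V (Suc i) \<times> W (Suc i))"
      unfolding subgrp_DirProd using group.DirProd_normal[OF gA gB V(3)[OF i] W(3)[OF i]] .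
    have iso: "(?A Mod V i) \<times>\<times> (?B Mod W i) \<cong> ?A \<times>\<times> ?B Mod V i \<times> W i"
      using group.FactGroup_DirProd_multiplication_iso_1[OF gA gB V(3)[OF i] W(3)[OF i]] .
    have "finite (carrier ?A)" "finite (carrier ?B)"
      using subgroup.subset[OF subV[of "Suc i"]] subgroup.subset[OF subW[of "Suc i"]] i assms(2,4)
      by (auto intro: finite_subset)
    hence "product_of_simple_groups ((?A Mod V i) \<times>\<times> (?B Mod W i))"
      using V(3,4)[OF i] W(3,4)[OF i]
      by (intro product_of_simple_groups_DirProd group_Mod finite_Mod)
    from product_of_simple_groups_iso[OF DirProd_group[OF group_Mod[OF V(3)[OF i]]
          group_Mod[OF W(3)[OF i]]] iso this]
    show "product_of_simple_groups (subgrp (G \<times>\<times> H) (V (Suc i) \<times> W (Suc i)) Mod V i \<times> W i)"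
      unfolding subgrp_DirProd .
  qed
qed

section \<open>Existence of series and first properties of \<open>mu\<close>\<close>

lemma card_Mod_less:
  assumes "finite (carrier G)" "N \<lhd> G" "N \<noteq> {\<one>\<^bsub>G\<^esub>}"
  shows "card (carrier (G Mod N)) < card (carrier G)"
proof -
  interpret N: normal N G by fact
  have one: "\<one>\<^bsub>G\<^esub> \<in> N" by (rule subgroup.one_closed[OF N.subgroup_axioms])
  hence "N \<noteq> {}" by blast
  hence "\<not> N \<subseteq> {\<one>\<^bsub>G\<^esub>}" using assms(3) by (simp add: subset_singleton_iff)
  then obtain x where x: "x \<in> N" "x \<noteq> \<one>\<^bsub>G\<^esub>" by (auto simp: subset_iff)
  \<comment> \<open>The coset map identifies the nontrivial element \<open>x\<close> of
    \<open>N\<close> with the identity.\<close>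
  have "\<not> inj_on (\<lambda>x. N #>\<^bsub>G\<^esub> x) (carrier G)"
  proof
    assume "inj_on (\<lambda>x. N #>\<^bsub>G\<^esub> x) (carrier G)"
    moreover have xG: "x \<in> carrier G" using x(1) N.subset by blast
    moreover have "N #>\<^bsub>G\<^esub> x = N" using rcos_eq_iff[OF assms(2) xG] x(1) by blast
    moreover have "N #>\<^bsub>G\<^esub> \<one>\<^bsub>G\<^esub> = N"
      using rcos_eq_iff[OF assms(2) N.is_group[THEN group.is_monoid, THEN monoid.one_closed]] one by blast
    ultimately have "x = \<one>\<^bsub>G\<^esub>"
      using inj_onD[of "\<lambda>x. N #>\<^bsub>G\<^esub> x" "carrier G" x "\<one>\<^bsub>G\<^esub>"] by simp
    with x show False by simp
  qed
  thus ?thesis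
    unfolding carrier_FactGroup using assms(1) card_image_le inj_on_iff_eq_card
    by (metis le_neq_implies_less)
qed

text \<open>Induction on the order: a group that is neither trivial nor simple is an extension of
  two smaller groups. This makes the \<open>LEAST\<close> in \<open>mu\<close> meaningful.\<close>

lemma ex_has_series:
  assumes "group G" "finite (carrier G)"
  shows "\<exists>l. has_series G l"
proof -
  \<comment> \<open>The induction hypothesis has a fixed type, while a quotient consists of cosets.
    Over the natural numbers the quotient can be replaced by its \<open>nat_copy\<close>.\<close>
  have "\<exists>l. has_series G l" if "group G" "finite (carrier G)" for G :: "nat monoid"
    using that
  proof (induction "card (carrier G)" arbitrary: G rule: less_induct)
    case less
    interpret group G by fact
    \<comment> \<open>Simple groups have order above 1, so the trivial group is a separate
      case.\<close>
    consider "carrier G = {\<one>\<^bsub>G\<^esub>}" | "simple_group G"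
      | N where "N \<lhd> G" "N \<noteq> carrier G" "N \<noteq> {\<one>\<^bsub>G\<^esub>}"
    proof (cases "order G > 1")
      case True
      thus ?thesis using that(2,3) is_group by (auto simp: simple_group_def simple_group_axioms_def)
    next
      case False
      hence "card (carrier G) = 1"
        using less.prems(2) by (simp add: order_def card_gt_0_iff Suc_leI le_antisym carrier_not_empty)
      thus ?thesis using that(1) one_closed by (metis card_1_singletonE singletonD)
    qed
    thus ?case
    proof cases
      case 1
      thus ?thesis using has_series_0 by blast
    next
      case 2
      thus ?thesis using has_series_1 product_of_simple_groups_simple less.prems by blast
    next
      case N: 3
      interpret N: normal N G by fact
      have gN: "group (subgrp G N)" using is_group N.subgroup_axioms by (rule group_subgrp)
      have "N \<subset> carrier G" using N N.subset by auto
      hence "card (carrier (subgrp G N)) < card (carrier G)" "finite (carrier (subgrp G N))"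
        using less.prems(2) by (auto intro: psubset_card_mono finite_subset)
      with less.hyps gN obtain a where a: "has_series (subgrp G N) a" by blast
      let ?Q = "nat_copy (G Mod N)"
      have Q: "group ?Q" "G Mod N \<cong> ?Q"
        using nat_copy group_Mod[OF N(1)] finite_Mod[OF less.prems(2)] by blast+
      have "card (carrier ?Q) = card (carrier (G Mod N))"
        using iso_same_card[OF Q(2)] by simp
      hence "card (carrier ?Q) < card (carrier G)"
        using card_Mod_less[OF less.prems(2) N(1,3)] by simp
      moreover have "finite (carrier ?Q)"
        using finite_iso[OF Q(2)] finite_Mod[OF less.prems(2)] by blast
      ultimately obtain b where "has_series ?Q b" using less.hyps Q(1) by blast
      hence "has_series (G Mod N) b"
        using has_series_iso[OF group_Mod[OF N(1)] finite_Mod[OF less.prems(2)] Q] by simp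
      with a show ?thesis using has_series_extension_normal[OF N(1)] by blast
    qed
  qed
  from this[of "nat_copy G"] show ?thesis
    using nat_copy[OF assms] has_series_iso[OF assms] finite_iso[of G "nat_copy G"] assms(2) by blast
qed

lemma mu_eq: "mu G = (LEAST l. has_series G l)"
  by (simp add: mu_def has_series_def)

lemma mu_le: "has_series G l \<Longrightarrow> mu G \<le> l"
  by (simp add: mu_eq Least_le)

lemma has_series_mu:
  assumes "group G" "finite (carrier G)" shows "has_series G (mu G)"
  unfolding mu_eq using ex_has_series[OF assms] by (rule LeastI_ex)

lemma mu_iso:
  assumes "group G" "finite (carrier G)" "group H" "G \<cong> H"
  shows "mu G = mu H"
  using has_series_iso[OF assms] by (simp add: mu_eq)

lemma mu_epi:
  assumes "group G" "finite (carrier G)" "group H" "f \<in> epi G H"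
  shows "mu H \<le> mu G"
  by (intro mu_le has_series_epi[OF assms] has_series_mu assms(1,2))

lemma mu_normal:
  assumes "group G" "finite (carrier G)" "N \<lhd> G"
  shows "mu (subgrp G N) \<le> mu G"
  by (intro mu_le has_series_normal[OF assms] has_series_mu assms(1,2))

text \<open>On the left \<open>mu\<close> is the instance for groups of natural numbers, on the
  right the instance for the type of \<open>G\<close>. Isomorphism invariance identifies their
  values.\<close>

lemma eval_mu:
  assumes "group G" "finite (carrier G)" shows "eval_group mu G = mu G"
  using mu_iso[OF assms nat_copy[OF assms]] by (simp add: eval_group_def)

lemma finite_normal: "finite (carrier G) \<Longrightarrow> N \<lhd> G \<Longrightarrow> finite N"
  by (rule finite_subset[OF subgroup.subset[OF normal_imp_subgroup]])

lemma group_normal: "N \<lhd> G \<Longrightarrow> group (subgrp G N)"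
  by (intro group_subgrp normal_imp_group normal_imp_subgroup)

section \<open>Complexity functions\<close>

text \<open>Extension comes from joining series, the quotient axiom from image series, and the
  product axiom from termwise products together with the two projections.\<close>

lemma mu_complexity_function: "complexity_function mu"
  unfolding complexity_function_def
proof (intro conjI allI impI)
  fix G :: "nat monoid" and N assume G: "group G" "finite (carrier G)" "N \<lhd> G"
  have gr: "group (subgrp G N)" "finite (carrier (subgrp G N))" "group (G Mod N)" "finite (carrier (G Mod N))"
    using G by (simp_all add: group_normal group_Mod finite_Mod finite_normal)
  show "eval_group mu G \<le> eval_group mu (subgrp G N) + eval_group mu (G Mod N)"
    unfolding eval_mu[OF G(1,2)] eval_mu[OF gr(1,2)] eval_mu[OF gr(3,4)]
    by (intro mu_le has_series_extension_normal[OF G(3)] has_series_mu gr)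
next
  fix G H :: "nat monoid" assume "group G" "finite (carrier G)" "group H" "epi G H \<noteq> {}"
  thus "mu H \<le> mu G" using mu_epi by blast
next
  fix G :: "nat monoid" assume G: "group G" "finite (carrier G)"
  from has_series_mu[OF this] obtain V where V: "subnormal_series G (mu G) V"
    "\<forall>i<mu G. product_of_simple_groups (subgrp G (V (Suc i)) Mod V i)"
    by (auto simp: has_series_def)
  \<comment> \<open>A series realizing \<open>mu G\<close> serves for constructability, as each of
    its factors has a series of length 1.\<close>
  have "eval_group mu (subgrp G (V (Suc i)) Mod V i) \<le> 1" if i: "i < mu G" for i
  proof -
    let ?A = "subgrp G (V (Suc i))"
    have n: "V i \<lhd> ?A" using V(1) i by (simp add: subnormal_series_def)
    have "subgroup (V (Suc i)) G" using subnormal_series_subgroup[OF G(1) V(1)] i by simp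
    hence "finite (carrier ?A)" using G(2) subgroup.subset by (auto intro: finite_subset)
    hence "eval_group mu (?A Mod V i) = mu (?A Mod V i)"
      by (intro eval_mu group_Mod[OF n] finite_Mod)
    also have "\<dots> \<le> 1" using V(2) i by (intro mu_le has_series_1 group_Mod[OF n]) simp
    finally show ?thesis .
  qed
  with V(1) show "\<exists>n V. subnormal_series G n V \<and> (\<forall>i<n. eval_group mu (subgrp G (V (Suc i)) Mod V i) \<le> 1)"
    by blast
next
  fix H K :: "nat monoid"
  assume gr: "group H" "finite (carrier H)" "group K" "finite (carrier K)"
  have HK: "group (H \<times>\<times> K)" "finite (carrier (H \<times>\<times> K))" using gr by (simp_all add: DirProd_group)
  \<comment> \<open>Both series are first lengthened to the larger of the two lengths.\<close>
  have "mu (H \<times>\<times> K) \<le> max (mu H) (mu K)"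
    using has_series_mono[OF gr(1) has_series_mu[OF gr(1,2)], of "max (mu H) (mu K)"]
      has_series_mono[OF gr(3) has_series_mu[OF gr(3,4)], of "max (mu H) (mu K)"]
    by (intro mu_le has_series_DirProd gr) simp_all
  moreover have "fst \<in> epi (H \<times>\<times> K) H"
    using group.is_monoid[OF gr(3)] by (auto simp: epi_def hom_def intro: monoid.one_closed)
  hence "mu H \<le> mu (H \<times>\<times> K)" using mu_epi[OF HK gr(1)] by blast
  moreover have "snd \<in> epi (H \<times>\<times> K) K"
    using group.is_monoid[OF gr(1)] by (auto simp: epi_def hom_def intro: monoid.one_closed)
  hence "mu K \<le> mu (H \<times>\<times> K)" using mu_epi[OF HK gr(3)] by blast
  ultimately show "eval_group mu (H \<times>\<times> K) = max (mu H) (mu K)"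
    unfolding eval_mu[OF HK] by simp
next
  fix G :: "nat monoid" assume "group G" "carrier G = {\<one>\<^bsub>G\<^esub>}"
  hence "mu G \<le> 0" by (intro mu_le has_series_0)
  thus "mu G = 0" by simp
qed

section \<open>Upper bounds for an arbitrary complexity function\<close>

context
  fixes c :: "nat monoid \<Rightarrow> nat"
  assumes c: "complexity_function c"
begin

lemma complexity_iso:
  fixes G H :: "nat monoid"
  assumes "group G" "finite (carrier G)" "group H" "G \<cong> H"
  shows "c G = c H"
proof -
  have "H \<cong> G" "finite (carrier H)" using assms group.iso_sym finite_iso by blast+
  hence "epi G H \<noteq> {}" "epi H G \<noteq> {}"
    using assms(4) iso_imp_epi unfolding is_iso_def by blast+
  thus ?thesis
    using c assms \<open>finite (carrier H)\<close> unfolding complexity_function_def by (meson le_antisym)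
qed

lemma eval_complexity_iso:
  assumes "group G" "finite (carrier G)" "group H" "G \<cong> H"
  shows "eval_group c G = eval_group c H"
proof -
  have finH: "finite (carrier H)" using assms finite_iso by blast
  note cp = nat_copy[OF assms(1,2)] nat_copy[OF assms(3) finH]
  have "nat_copy G \<cong> nat_copy H"
    using iso_trans[OF group.iso_sym[OF assms(1) cp(2)] iso_trans[OF assms(4) cp(4)]] .
  thus ?thesis
    unfolding eval_group_def using complexity_iso cp(1,3) finite_iso[OF cp(2) assms(2)] by blast
qed

lemma eval_complexity_nat:
  fixes G :: "nat monoid"
  assumes "group G" "finite (carrier G)" shows "eval_group c G = c G"
  unfolding eval_group_def using complexity_iso[OF assms nat_copy[OF assms]] by simp

text \<open>In the series given by constructability, the last term before \<open>S\<close> is first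
  reached is normal in \<open>S\<close> and proper, hence trivial. So one factor is isomorphic to
  \<open>S\<close> itself.\<close>

lemma complexity_simple:
  fixes S :: "nat monoid"
  assumes "simple_group S" "finite (carrier S)"
  shows "c S \<le> 1"
proof -
  interpret simple_group S by fact
  obtain n V where V: "subnormal_series S n V"
    and le: "\<And>i. i < n \<Longrightarrow> eval_group c (subgrp S (V (Suc i)) Mod V i) \<le> 1"
    using c is_group assms(2) unfolding complexity_function_def by blast
  \<comment> \<open>The series may repeat the whole group at its end, so the first index that
    reaches it is taken. It is positive because \<open>V 0\<close> is trivial.\<close>
  define k where "k = (LEAST i. V i = carrier S)"
  have "V n = carrier S" using V by (simp add: subnormal_series_def)
  hence Vk: "V k = carrier S" and "k \<le> n"
    unfolding k_def by (rule LeastI, rule Least_le)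
  moreover have "k \<noteq> 0" using Vk V simple_not_triv by (auto simp: subnormal_series_def)
  ultimately obtain i where i: "k = Suc i" "i < n" by (cases k) auto
  have "V i \<noteq> carrier S" using i(1) not_less_Least[of i "\<lambda>i. V i = carrier S"] unfolding k_def by auto
  moreover have "V i \<lhd> S" using V i Vk by (auto simp: subnormal_series_def)
  ultimately have "V i = {\<one>\<^bsub>S\<^esub>}" using no_real_normal_subgroup by blast
  hence "eval_group c (S Mod {\<one>\<^bsub>S\<^esub>}) \<le> 1" using le[OF i(2)] i(1) Vk by simp
  also have "eval_group c (S Mod {\<one>\<^bsub>S\<^esub>}) = eval_group c S"
    by (intro eval_complexity_iso group_Mod one_is_normal finite_Mod assms is_group Mod_one_iso)
  finally show ?thesis by (simp add: eval_complexity_nat is_group assms(2))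
qed

text \<open>By induction on the number of factors, the product axiom gives a maximum of values that
  are at most 1. The empty product has value 0 by the initial condition.\<close>

lemma complexity_product_of_simple_groups:
  assumes "group G" "finite (carrier G)" "product_of_simple_groups G"
  shows "eval_group c G \<le> 1"
proof (rule product_of_simple_groups_iso_induct[OF assms(3,1), where P = "\<lambda>T. eval_group c T \<le> 1"])
  fix T :: "(nat \<Rightarrow> nat) monoid"
  assume T: "group T" "carrier T = {\<one>\<^bsub>T\<^esub>}"
  hence fin: "finite (carrier T)" by (metis finite.simps)
  note cp = nat_copy[OF T(1) fin]
  have "carrier (nat_copy T) = {\<one>\<^bsub>nat_copy T\<^esub>}"
    using isomorphic_group_triviality[OF cp(2) T(1) cp(1)] T by (simp add: trivial_group_def cp)
  hence "c (nat_copy T) = 0"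
    using c cp(1) unfolding complexity_function_def by blast
  thus "eval_group c T \<le> 1" by (simp add: eval_group_def)
next
  fix T K :: "(nat \<Rightarrow> nat) monoid" and S :: "nat monoid"
  assume T: "group T" "finite (carrier T)" "eval_group c T \<le> 1"
    and S: "simple_group S" "finite (carrier S)" and K: "group K" "K \<cong> T \<times>\<times> S"
  have gS: "group S" using S(1) by (simp add: simple_group_def)
  \<comment> \<open>The product axiom concerns groups of natural numbers, so \<open>T\<close> is
    replaced by its copy.\<close>
  note cp = nat_copy[OF T(1,2)]
  have "K \<cong> nat_copy T \<times>\<times> S"
    using iso_trans[OF K(2) group.DirProd_iso_trans[OF T(1) cp(2) iso_refl]] .
  moreover have finK: "finite (carrier K)"
    using finite_iso[OF group.iso_sym[OF K]] T S by simp
  ultimately have "eval_group c K = eval_group c (nat_copy T \<times>\<times> S)"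
    by (intro eval_complexity_iso K(1) DirProd_group cp(1) gS)
  also have "\<dots> = max (c (nat_copy T)) (c S)"
    using c cp(1) finite_iso[OF cp(2) T(2)] gS S(2) unfolding complexity_function_def by blast
  also have "\<dots> \<le> 1" using T(3) complexity_simple[OF S] by (simp add: eval_group_def)
  finally show "eval_group c K \<le> 1" .
next
  fix T :: "(nat \<Rightarrow> nat) monoid"
  assume "group T" "G \<cong> T" "eval_group c T \<le> 1"
  thus "eval_group c G \<le> 1" using eval_complexity_iso[OF assms(1,2), of T] by simp
qed

text \<open>Climbing the series, the extension axiom adds at most 1 per step, so \<open>V i\<close>
  has complexity at most \<open>i\<close>.\<close>

lemma complexity_le_series:
  fixes G :: "nat monoid"
  assumes "group G" "finite (carrier G)" "has_series G l"
  shows "eval_group c G \<le> l"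
proof -
  from has_seriesE[OF assms(3,1)] obtain V where
    V: "V 0 = {\<one>\<^bsub>G\<^esub>}" "V l = carrier G"
    "\<And>i. i < l \<Longrightarrow> V i \<lhd> subgrp G (V (Suc i))"
    "\<And>i. i < l \<Longrightarrow> product_of_simple_groups (subgrp G (V (Suc i)) Mod V i)"
    and sub: "\<And>i. i \<le> l \<Longrightarrow> subgroup (V i) G" by blast
  have gr: "group (subgrp G (V i))" "finite (carrier (subgrp G (V i)))" if "i \<le> l" for i
    using sub[OF that] assms(1,2) subgroup.subset[OF sub[OF that]]
    by (auto simp: group_subgrp intro: finite_subset)
  have "eval_group c (subgrp G (V i)) \<le> i" if "i \<le> l" for i
    using that
  proof (induction i)
    case 0
    have "c (subgrp G (V 0)) = 0"
      using c gr(1)[of 0] V(1) unfolding complexity_function_def by simp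
    thus ?case using gr[of 0] by (simp add: eval_complexity_nat)
  next
    case (Suc i)
    let ?A = "subgrp G (V (Suc i))"
    have i: "i < l" using Suc.prems by simp
    have "eval_group c ?A \<le> eval_group c (subgrp ?A (V i)) + eval_group c (?A Mod V i)"
      using c gr[OF Suc.prems] V(3)[OF i] unfolding complexity_function_def by blast
    also have "eval_group c (subgrp ?A (V i)) \<le> i" using Suc by simp
    also have "eval_group c (?A Mod V i) \<le> 1"
      using gr[OF Suc.prems] V(3,4)[OF i]
      by (intro complexity_product_of_simple_groups group_Mod finite_Mod)
    finally show ?case by simp
  qed
  from this[of l] V(2) show ?thesis by simp
qed

lemma complexity_le_mu:
  assumes "group G" "finite (carrier G)"
  shows "eval_group c G \<le> mu G"
proof -
  note cp = nat_copy[OF assms]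
  have fin: "finite (carrier (nat_copy G))" using finite_iso[OF cp(2) assms(2)] .
  have "eval_group c G = eval_group c (nat_copy G)"
    by (rule eval_complexity_iso[OF assms cp])
  also have "\<dots> \<le> mu (nat_copy G)"
    by (intro complexity_le_series cp(1) fin has_series_mu)
  also have "\<dots> = mu G" using mu_iso[OF assms cp] by simp
  finally show ?thesis .
qed

end

text \<open>The supremum is a maximum: \<open>mu\<close> is itself a complexity function and bounds
  all the others.\<close>

lemma cx_eq_mu:
  assumes "group G" "finite (carrier G)"
  shows "cx G = mu G"
  unfolding cx_def
proof (rule cSup_eq_maximum)
  show "mu G \<in> {eval_group c G |c. complexity_function c}"
    using eval_mu[OF assms] mu_complexity_function by force
qed (use complexity_le_mu[OF _ assms] in auto)

theorem theorem4p8: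
  fixes G :: "('a, 'b) monoid_scheme" and N :: "'a set"
  assumes "group G" and "finite (carrier G)" and "N \<lhd> G"
  shows "mu (subgrp G N) \<le> mu G \<and> cx (subgrp G N) \<le> cx G"
  using mu_normal[OF assms] cx_eq_mu[OF assms(1,2)]
    cx_eq_mu[of "subgrp G N"] group_normal[OF assms(3)] finite_normal[OF assms(2,3)]
  by simp

end
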